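(* Fix $b\in\{0,1\}^{\mathbb{N}}$ and let $P(u,x,y):\equiv u_{n-1}<x\wedge((b_x=1\wedge x\le y)\to b_y=1)$ for $u=[u_0,\dots,u_{n-1}]\in\mathbb{N}^\ast$, $x,y\in\mathbb{N}$ (conjunct $u_{n-1}<x$ omitted for $u=[\,]$). Let $\mathcal{A}_\omega$ be the two-oracle algorithm defined as follows. States are $\langle\sigma,a\mid o_1,o_2\rangle$ with $\sigma\in(\{\mathsf{s},\mathsf{e}_1,\mathsf{e}_2\}\times\mathbb{N})^\ast$, $a\in\mathbb{N}^\ast$, $o_1,o_2\in\mathbb{N}\cup\{\Box\}$; the initial state is $\langle[(\mathsf{s},0)],[\,]\mid\Box,\Box\rangle$; $Q_1$ consists of states $\langle\sigma::(c,x),[\,]\mid\Box,\Box\rangle$ with $c\in\{\mathsf{s},\mathsf{e}_1\}$; $Q_2$ consists of states $\langle\sigma,[\,]\mid n,\Box\rangle$ with $n<|\sigma|$; end states are $\langle[\,],a\mid n,y\rangle$ with $n,y\in\mathbb{N}$; $\xi_\omega(\sigma,a):=\sigma_2::a::\mathbf{0}\in\mathbb{N}^{\mathbb{N}}$, where $\sigma_2\in\mathbb{N}^\ast$ is the sequence of second components of $\sigma$. Transitions: (a) $\langle\sigma::(c,x),[\,]\mid n,\Box\rangle\rhd_\omega\langle\sigma::(c,x)::(\mathsf{s},x+1),[\,]\mid\Box,\Box\rangle$; (b) $\langle\sigma::(\mathsf{e}_i,x),a\mid n,y\rangle\rhd_\omega\langle\sigma,x::a\mid n,y\rangle$ ($i=1,2$);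 (c) $\langle\sigma::(\mathsf{s},x),a\mid n,y\rangle\rhd_\omega\langle\sigma::(\mathsf{e}_1,y),[\,]\mid\Box,\Box\rangle$ if $b_x=1\wedge x\le y\wedge b_y=0$, and $\rhd_\omega\langle\sigma::(\mathsf{e}_2,x),a\mid n,y\rangle$ otherwise. With oracles $\phi_1,\phi_2:\mathbb{N}^{\mathbb{N}}\to\mathbb{N}$, a state $\langle\sigma,a\mid\Box,\Box\rangle\in Q_1$ moves to $\langle\sigma,a\mid\phi_1(\xi_\omega(\sigma,a)),\Box\rangle$, a state $\langle\sigma,a\mid n,\Box\rangle\in Q_2$ moves to $\langle\sigma,a\mid n,\phi_2(\xi_\omega(\sigma,a))\rangle$, and all other states move by $\rhd_\omega$. Then for all oracles $\phi_1,\phi_2$: if an end state $\langle[\,],a\mid n,y\rangle$ is reachable, then $P(\overline{\alpha}n,\alpha_n,y)$ holds for $\alpha:=a::\mathbf{0}$.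
   Context: $\mathbb{N}^\ast$ denotes finite sequences of naturals (similarly $Z^\ast$), $[\,]$ the empty sequence, $|\sigma|$ the length, $::$ extension/concatenation, $\mathbf{0}$ the constant zero sequence, and $\overline{\alpha}n:=[\alpha_0,\dots,\alpha_{n-1}]$. $\Box$ is a fresh symbol ("empty answer"). A state is reachable if there is a finite sequence of moves (as specified) from the initial state to it in which no state before the last is an end state. *)

theory Defs
  imports "HOL-Library.Omega_Words_Fun"
begin

text \<open>Finite sequences are lists and infinite sequences are functions on \<^typ>\<open>nat\<close>. The extension
  \<open>\<sigma> :: z\<close> is \<open>\<sigma> @ [z]\<close>, so the last entry of \<open>\<sigma>\<close> is the one the transitions act on.\<close>

definition P :: "(nat \<Rightarrow> nat) \<Rightarrow> nat list \<Rightarrow> nat \<Rightarrow> nat \<Rightarrow> bool" where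
  "P b u x y \<longleftrightarrow> (u \<noteq> [] \<longrightarrow> last u < x) \<and> (b x = 1 \<and> x \<le> y \<longrightarrow> b y = 1)"

datatype label = S | E1 | E2

text \<open>\<open>State \<sigma> a o1 o2\<close> is the state \<open>\<langle>\<sigma>, a | o1, o2\<rangle>\<close>; the empty answer is \<^const>\<open>None\<close>.\<close>

datatype state = State "(label \<times> nat) list" "nat list" "nat option" "nat option"

definition initial_state :: state where
  "initial_state = State [(S, 0)] [] None None"

definition Q1 :: "state set" where
  "Q1 = {State (\<sigma> @ [(c, x)]) [] None None | \<sigma> c x. c \<in> {S, E1}}"

definition Q2 :: "state set" where
  "Q2 = {State \<sigma> [] (Some n) None | \<sigma> n. n < length \<sigma>}"

definition end_states :: "state set" where
  "end_states = {State [] a (Some n) (Some y) | a n y. True}"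

definition \<xi> :: "(label \<times> nat) list \<Rightarrow> nat list \<Rightarrow> (nat \<Rightarrow> nat)" where
  "\<xi> \<sigma> a = map snd \<sigma> \<frown> a \<frown> (\<lambda>_. 0)"

text \<open>The first clause overlaps with \<^const>\<open>Q2\<close>; the oracle move takes precedence in \<open>move\<close>, so the
  clause takes effect only when \<open>n\<close> is at least the length of the first component.\<close>

inductive trans_step :: "(nat \<Rightarrow> nat) \<Rightarrow> state \<Rightarrow> state \<Rightarrow> bool" for b where
  extend: "trans_step b (State (\<sigma> @ [(c, x)]) [] (Some n) None)
             (State (\<sigma> @ [(c, x), (S, x + 1)]) [] None None)"
| pop: "c \<in> {E1, E2} \<Longrightarrow>
    trans_step b (State (\<sigma> @ [(c, x)]) a (Some n) (Some y)) (State \<sigma> (x # a) (Some n) (Some y))"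
| learn: "b x = 1 \<and> x \<le> y \<and> b y = 0 \<Longrightarrow>
    trans_step b (State (\<sigma> @ [(S, x)]) a (Some n) (Some y)) (State (\<sigma> @ [(E1, y)]) [] None None)"
| accept: "\<not> (b x = 1 \<and> x \<le> y \<and> b y = 0) \<Longrightarrow>
    trans_step b (State (\<sigma> @ [(S, x)]) a (Some n) (Some y))
      (State (\<sigma> @ [(E2, x)]) a (Some n) (Some y))"

inductive move ::
  "(nat \<Rightarrow> nat) \<Rightarrow> ((nat \<Rightarrow> nat) \<Rightarrow> nat) \<Rightarrow> ((nat \<Rightarrow> nat) \<Rightarrow> nat) \<Rightarrow> state \<Rightarrow> state \<Rightarrow> bool"
  for b \<phi>1 \<phi>2 where
  query1: "State \<sigma> a None None \<in> Q1 \<Longrightarrow>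
    move b \<phi>1 \<phi>2 (State \<sigma> a None None) (State \<sigma> a (Some (\<phi>1 (\<xi> \<sigma> a))) None)"
| query2: "State \<sigma> a (Some n) None \<in> Q2 \<Longrightarrow>
    move b \<phi>1 \<phi>2 (State \<sigma> a (Some n) None) (State \<sigma> a (Some n) (Some (\<phi>2 (\<xi> \<sigma> a))))"
| internal: "s \<notin> Q1 \<Longrightarrow> s \<notin> Q2 \<Longrightarrow> trans_step b s s' \<Longrightarrow> move b \<phi>1 \<phi>2 s s'"

definition reachable ::
  "(nat \<Rightarrow> nat) \<Rightarrow> ((nat \<Rightarrow> nat) \<Rightarrow> nat) \<Rightarrow> ((nat \<Rightarrow> nat) \<Rightarrow> nat) \<Rightarrow> state \<Rightarrow> bool" where
  "reachable b \<phi>1 \<phi>2 s \<longleftrightarrow>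
     (\<lambda>s s'. s \<notin> end_states \<and> move b \<phi>1 \<phi>2 s s')\<^sup>*\<^sup>* initial_state s"

end

theory Submission
  imports Defs
begin

text \<open>The values on the stack \<open>\<sigma>\<close> followed by \<open>a\<close> are strictly increasing in every reachable state, and
  an entry is marked \<^const>\<open>E1\<close> only when its value is a zero of \<open>b\<close>. Once \<open>y\<close> is known, an entry moves
  from \<open>\<sigma>\<close> to \<open>a\<close> only if it is compatible with \<open>y\<close>, either because it is such a zero or because it was
  tested (\<^const>\<open>E2\<close>). Only the top of \<open>\<sigma>\<close> is ever marked \<^const>\<open>E2\<close>, so no stale test survives when
  \<open>y\<close> is discarded. Hence in an end state all entries of \<open>a\<close> are compatible with \<open>y\<close>, and
  \<open>n < length a\<close> because \<open>y\<close> was only asked for when \<open>n\<close> was below the length of the stack.\<close>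

definition compatible :: "(nat \<Rightarrow> nat) \<Rightarrow> nat \<Rightarrow> nat \<Rightarrow> bool" where
  "compatible b x y \<longleftrightarrow> (b x = 1 \<and> x \<le> y \<longrightarrow> b y = 1)"

fun invariant :: "(nat \<Rightarrow> nat) \<Rightarrow> state \<Rightarrow> bool" where
  "invariant b (State \<sigma> a o1 o2) \<longleftrightarrow>
     sorted_wrt (<) (map snd \<sigma> @ a) \<and> (\<forall>x. (E1, x) \<in> set \<sigma> \<longrightarrow> b x = 0) \<and>
     (case o2 of
        None \<Rightarrow> a = [] \<and> E2 \<notin> fst ` set \<sigma>
      | Some y \<Rightarrow> E2 \<notin> fst ` set (butlast \<sigma>) \<and>
          (\<exists>n. o1 = Some n \<and> n < length \<sigma> + length a) \<and>
          (\<forall>x. x \<in> set a \<or> (E2, x) \<in> set \<sigma> \<longrightarrow> compatible b x y))"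

lemma invariant_trans_step:
  assumes "trans_step b s s'" "invariant b s" "range b \<subseteq> {0, 1}"
  shows "invariant b s'"
  using assms(1)
proof cases
  case (extend \<sigma> c x n)
  then show ?thesis
    using assms(2) by (auto simp: sorted_wrt_append)
next
  case (pop c \<sigma> x a n y)
  \<comment> \<open>A popped \<open>E1\<close> entry has \<open>b x = 0\<close>, so it is compatible
    with any \<open>y\<close>.\<close>
  then show ?thesis
    using assms(2) by (auto simp: sorted_wrt_append compatible_def dest: in_set_butlastD)
next
  case (learn x y \<sigma> a n)
  \<comment> \<open>Entries below \<open>x\<close> are also below its replacement \<open>y\<close>,
    as \<open>x \<le> y\<close>.\<close>
  then show ?thesis
    using assms(2) by (auto simp: sorted_wrt_append compatible_def)
next
  case (accept x y \<sigma> a n)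
  \<comment> \<open>This turns \<open>b y \<noteq> 0\<close> into the \<open>b y = 1\<close> of
    \<open>compatible\<close>.\<close>
  have "b y \<in> {0, 1}"
    using assms(3) by blast
  then show ?thesis
    using accept assms(2) by (auto simp: sorted_wrt_append compatible_def)
qed

lemma invariant_move:
  assumes "move b \<phi>1 \<phi>2 s s'" "invariant b s" "range b \<subseteq> {0, 1}"
  shows "invariant b s'"
  using assms(1)
proof cases
  case (query1 \<sigma> a)
  then show ?thesis
    using assms(2) by auto
next
  case (query2 \<sigma> a n)
  \<comment> \<open>\<open>Q2\<close> supplies the length bound; with \<open>a\<close> empty and no
    \<open>E2\<close> mark, compatibility is vacuous.\<close>
  then show ?thesis
    using assms(2) by (auto simp: Q2_def image_iff dest: in_set_butlastD)
next
  case internal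
  then show ?thesis
    using assms(2,3) invariant_trans_step by blast
qed

lemma invariant_reachable:
  assumes "reachable b \<phi>1 \<phi>2 s" "range b \<subseteq> {0, 1}"
  shows "invariant b s"
  using assms(1) unfolding reachable_def
proof (induction rule: rtranclp_induct)
  case base
  show ?case by (simp add: initial_state_def)
next
  case (step s s')
  then show ?case
    using invariant_move assms(2) by blast
qed

theorem theorem6p4:
  fixes b :: "nat \<Rightarrow> nat" and \<phi>1 \<phi>2 :: "(nat \<Rightarrow> nat) \<Rightarrow> nat"
    and a :: "nat list" and n y :: nat
  assumes "range b \<subseteq> {0, 1}"
    and "State [] a (Some n) (Some y) \<in> end_states"
    and "reachable b \<phi>1 \<phi>2 (State [] a (Some n) (Some y))"
  shows "let \<alpha> = a \<frown> (\<lambda>_. 0) in P b (prefix n \<alpha>) (\<alpha> n) y"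
proof -
  have inv: "invariant b (State [] a (Some n) (Some y))"
    using invariant_reachable assms(3,1) .
  then have n: "n < length a" and sorted: "sorted_wrt (<) a"
    by auto
  have "compatible b (a ! n) y"
    using inv n by simp
  \<comment> \<open>As \<open>n < length a\<close>, the last entry of the prefix is
    \<open>a ! (n - 1)\<close>, not a padding zero.\<close>
  moreover have "last (prefix n (a \<frown> (\<lambda>_. 0))) < a ! n" if "n > 0"
    using that n sorted_wrt_nth_less[OF sorted, of "n - 1" n] by (subst last_conv_nth) auto
  ultimately show ?thesis
    using n by (auto simp: Let_def P_def compatible_def)
qed

end
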